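(* Let $\mathcal{A}$ be a unital $C^*$-algebra, let $H$ and $V$ be Hilbert $\mathcal{A}$-modules, let $(\Omega,\mu)$ be a measure space, let $\{H_\omega\}_{\omega\in\Omega}$ be a family of closed submodules of $V$, and let $K\in End_{\mathcal{A}}^{*}(H)$. Let $\{\Lambda_\omega\in End_{\mathcal{A}}^{*}(H,H_\omega)\}_{\omega\in\Omega}$ be a continuous $*$-g-Bessel family for $H$ with respect to $\{H_\omega\}_{\omega\in\Omega}$, with frame operator $S$, $Sx=\int_\Omega\Lambda_\omega^*\Lambda_\omega x\,d\mu(\omega)$. Then $\{\Lambda_\omega\}_{\omega\in\Omega}$ is a continuous $*$-K-g-frame for $H$ with respect to $\{H_\omega\}_{\omega\in\Omega}$ if and only if there exists a constant $A>0$ such that $S\ge A\,KK^*$.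
   Context: Hilbert $\mathcal{A}$-modules are left modules over the unital $C^*$-algebra $\mathcal{A}$ with $\mathcal{A}$-valued inner product $\langle\cdot,\cdot\rangle$, $\mathcal{A}$-linear in the first variable, and norm $\|x\|=\|\langle x,x\rangle\|^{1/2}$. $End_{\mathcal{A}}^{*}(H,W)$ is the set of adjointable operators from $H$ to $W$, and $End_{\mathcal{A}}^{*}(H)=End_{\mathcal{A}}^{*}(H,H)$. Inequalities between elements of $\mathcal{A}$ are in the usual order on selfadjoint elements; for selfadjoint $P,Q\in End_{\mathcal{A}}^{*}(H)$, $P\ge Q$ means $\langle Px,x\rangle\ge\langle Qx,x\rangle$ for all $x\in H$. The constant $A>0$ in the claim is a real number. Continuous $*$-K-g-frame: given $K\in End_{\mathcal{A}}^{*}(H)$, a family $\{\Lambda_\omega\in End_{\mathcal{A}}^{*}(H,H_\omega)\}_{\omega\in\Omega}$ is a continuous $*$-K-g-frame for $H$ with respect to $\{H_\omega\}_{\omega\in\Omega}$ if (1) for every $x\in H$ the function $\omega\mapsto\Lambda_\omega x$ (viewed as $V$-valued) is measurable, and (2) there are strictly nonzero elements $A',B\in\mathcal{A}$ (strictly nonzero means $0$ is not in the spectrum, i.e. the element is invertible) such that $$A'\langle K^*x,K^*x\rangle A'^*\le\int_\Omega\langle\Lambda_\omega x,\Lambda_\omega x\rangle\,d\mu(\omega)\le B\langle x,x\rangle B^*\quad\text{for all }x\in H.$$ The family is called continuous $*$-g-Bessel if (1) holds and the right-hand inequality in (2) holds for some strictly nonzero $B\in\mathcal{A}$. Integrals of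 functions with values in $\mathcal{A}$ or in a Hilbert module are Bochner integrals; in particular, for the given family $\{\Lambda_\omega\}$, the integrals in the definition of the Bessel property and of the operator $S$ are assumed to exist for every $x\in H$. *)

theory Defs
  imports "HOL-Analysis.Analysis"
begin

section \<open>Unital $C^*$-algebras\<close>

text \<open>
  Complex scalars are needed for the spectrum and for the conjugate linearity of the involution;
  the underlying real scalar multiplication is the one of \<open>real_normed_algebra_1\<close>.
\<close>

class unital_cstar_algebra = real_normed_algebra_1 + banach +
  fixes scaleC :: "complex \<Rightarrow> 'a \<Rightarrow> 'a"  (infixr "*\<^sub>C" 75)
    and star :: "'a \<Rightarrow> 'a"
  assumes scaleC_add_right: "c *\<^sub>C (x + y) = c *\<^sub>C x + c *\<^sub>C y"
    and scaleC_add_left: "(c + d) *\<^sub>C x = c *\<^sub>C x + d *\<^sub>C x"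
    and scaleC_scaleC: "c *\<^sub>C d *\<^sub>C x = (c * d) *\<^sub>C x"
    and scaleC_of_real: "complex_of_real r *\<^sub>C x = r *\<^sub>R x"
    and mult_scaleC_left: "(c *\<^sub>C x) * y = c *\<^sub>C (x * y)"
    and mult_scaleC_right: "x * (c *\<^sub>C y) = c *\<^sub>C (x * y)"
    and norm_scaleC: "norm (c *\<^sub>C x) = cmod c * norm x"
    and star_star: "star (star x) = x"
    and star_add: "star (x + y) = star x + star y"
    and star_scaleC: "star (c *\<^sub>C x) = cnj c *\<^sub>C star x"
    and star_mult: "star (x * y) = star y * star x"
    and norm_star_mult_self: "norm (star x * x) = (norm x)\<^sup>2"

definition alg_invertible :: "'a::monoid_mult \<Rightarrow> bool"
  where "alg_invertible a \<longleftrightarrow> (\<exists>b. a * b = 1 \<and> b * a = 1)"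

definition spectrum :: "'a::unital_cstar_algebra \<Rightarrow> complex set"
  where "spectrum a = {c. \<not> alg_invertible (c *\<^sub>C 1 - a)}"

definition strictly_nonzero :: "'a::unital_cstar_algebra \<Rightarrow> bool"
  where "strictly_nonzero a \<longleftrightarrow> 0 \<notin> spectrum a"

definition cstar_positive :: "'a::unital_cstar_algebra \<Rightarrow> bool"
  where "cstar_positive a \<longleftrightarrow> star a = a \<and> spectrum a \<subseteq> complex_of_real ` {0..}"

definition cstar_le :: "'a::unital_cstar_algebra \<Rightarrow> 'a \<Rightarrow> bool"  (infix "\<le>\<^sub>A" 50)
  where "a \<le>\<^sub>A b \<longleftrightarrow> cstar_positive (b - a)"


section \<open>Hilbert modules and adjointable operators\<close>

text \<open>
  Left modules, with an inner product that is linear in its first argument.  The norm is that of the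
  carrier type, tied to the inner product by \<open>norm_eq\<close>; completeness is the sort \<open>banach\<close>.
  The complex scalar multiplication of the module is \<open>\<lambda>c x. act (c *\<^sub>C 1) x\<close>.
\<close>

locale hilbert_module =
  fixes act :: "'a::unital_cstar_algebra \<Rightarrow> 'h::banach \<Rightarrow> 'h"
    and ip :: "'h \<Rightarrow> 'h \<Rightarrow> 'a"
  assumes act_add_right: "act a (x + y) = act a x + act a y"
    and act_add_left: "act (a + b) x = act a x + act b x"
    and act_act: "act a (act b x) = act (a * b) x"
    and act_one: "act 1 x = x"
    and act_of_real: "act (of_real r) x = r *\<^sub>R x"
    and ip_add_left: "ip (x + y) z = ip x z + ip y z"
    and ip_act_left: "ip (act a x) z = a * ip x z"
    and ip_star: "ip y x = star (ip x y)"
    and ip_positive: "cstar_positive (ip x x)"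
    and ip_definite: "ip x x = 0 \<Longrightarrow> x = 0"
    and norm_eq: "norm x = sqrt (norm (ip x x))"

definition closed_submodule :: "('a \<Rightarrow> 'v::banach \<Rightarrow> 'v) \<Rightarrow> 'v set \<Rightarrow> bool"
  where "closed_submodule act W \<longleftrightarrow>
    0 \<in> W \<and> (\<forall>x\<in>W. \<forall>y\<in>W. x + y \<in> W) \<and> (\<forall>a. \<forall>x\<in>W. act a x \<in> W) \<and> closed W"

text \<open>
  \<open>End_star ipH ipV W\<close> is the set of adjointable operators from \<open>H\<close> into the submodule \<open>W\<close> of
  \<open>V\<close>, with \<open>W\<close> carrying the inner product of \<open>V\<close>.  The adjoint only has to exist on \<open>W\<close>, which need
  not be complemented in \<open>V\<close>.  Linearity and boundedness are automatic.
\<close>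

definition End_star :: "('h \<Rightarrow> 'h \<Rightarrow> 'a) \<Rightarrow> ('v \<Rightarrow> 'v \<Rightarrow> 'a) \<Rightarrow> 'v set \<Rightarrow> ('h \<Rightarrow> 'v) set"
  where "End_star ipH ipV W =
    {T. range T \<subseteq> W \<and> (\<exists>T'. \<forall>x. \<forall>y\<in>W. ipV (T x) y = ipH x (T' y))}"

text \<open>
  For \<open>T \<in> End_star ipH ipV W\<close> the value is determined for \<open>y \<in> W\<close>, and only used there.
\<close>

definition adj :: "('h \<Rightarrow> 'h \<Rightarrow> 'a) \<Rightarrow> ('v \<Rightarrow> 'v \<Rightarrow> 'a) \<Rightarrow> ('h \<Rightarrow> 'v) \<Rightarrow> 'v \<Rightarrow> 'h"
  where "adj ipH ipV T y = (THE z. \<forall>x. ipV (T x) y = ipH x z)"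

definition op_le ::
  "('h \<Rightarrow> 'h \<Rightarrow> 'a::unital_cstar_algebra) \<Rightarrow> ('h \<Rightarrow> 'h) \<Rightarrow> ('h \<Rightarrow> 'h) \<Rightarrow> bool"
  where "op_le ip Q P \<longleftrightarrow> (\<forall>x. ip (Q x) x \<le>\<^sub>A ip (P x) x)"


section \<open>The Bochner integral in arbitrary Banach spaces\<close>

text \<open>
  The library's \<open>has_bochner_integral\<close> is restricted to second countable (hence separable) spaces.
  Here Borel measurability of the integrand, which in non-separable spaces is not stable under sums,
  is replaced by strong measurability: being an almost everywhere limit of simple functions.  The
  lower integral \<open>nn_integral\<close> agrees for \<open>M\<close> and its completion, for which
  \<open>norm (f \<omega> - s i \<omega>)\<close> is measurable.
\<close>

definition has_integral_bochner :: "'w measure \<Rightarrow> ('w \<Rightarrow> 'b::banach) \<Rightarrow> 'b \<Rightarrow> bool"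
  where "has_integral_bochner M f I \<longleftrightarrow>
    (\<exists>s. (\<forall>i. Bochner_Integration.simple_bochner_integrable M (s i)) \<and>
         (AE \<omega> in M. (\<lambda>i. s i \<omega>) \<longlonglongrightarrow> f \<omega>) \<and>
         (\<lambda>i. \<integral>\<^sup>+\<omega>. norm (f \<omega> - s i \<omega>) \<partial>M) \<longlonglongrightarrow> 0 \<and>
         (\<lambda>i. Bochner_Integration.simple_bochner_integral M (s i)) \<longlonglongrightarrow> I)"

definition integrable_bochner :: "'w measure \<Rightarrow> ('w \<Rightarrow> 'b::banach) \<Rightarrow> bool"
  where "integrable_bochner M f \<longleftrightarrow> (\<exists>I. has_integral_bochner M f I)"

definition integral_bochner :: "'w measure \<Rightarrow> ('w \<Rightarrow> 'b::banach) \<Rightarrow> 'b"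
  where "integral_bochner M f = (THE I. has_integral_bochner M f I)"


section \<open>Continuous $*$-g-Bessel families and $*$-K-g-frames\<close>

definition continuous_star_g_Bessel ::
  "'w measure \<Rightarrow> ('h::banach \<Rightarrow> 'h \<Rightarrow> 'a::unital_cstar_algebra) \<Rightarrow> ('v::banach \<Rightarrow> 'v \<Rightarrow> 'a) \<Rightarrow>
    ('w \<Rightarrow> 'v set) \<Rightarrow> ('w \<Rightarrow> 'h \<Rightarrow> 'v) \<Rightarrow> bool"
  where "continuous_star_g_Bessel M ipH ipV Hs \<Lambda> \<longleftrightarrow>
    (\<forall>\<omega>\<in>space M. \<Lambda> \<omega> \<in> End_star ipH ipV (Hs \<omega>)) \<and>
    (\<forall>x. (\<lambda>\<omega>. \<Lambda> \<omega> x) \<in> borel_measurable M) \<and>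
    (\<forall>x. integrable_bochner M (\<lambda>\<omega>. ipV (\<Lambda> \<omega> x) (\<Lambda> \<omega> x))) \<and>
    (\<exists>B. strictly_nonzero B \<and>
      (\<forall>x. integral_bochner M (\<lambda>\<omega>. ipV (\<Lambda> \<omega> x) (\<Lambda> \<omega> x)) \<le>\<^sub>A B * ipH x x * star B))"

definition continuous_star_K_g_frame ::
  "'w measure \<Rightarrow> ('h::banach \<Rightarrow> 'h \<Rightarrow> 'a::unital_cstar_algebra) \<Rightarrow> ('v::banach \<Rightarrow> 'v \<Rightarrow> 'a) \<Rightarrow>
    ('w \<Rightarrow> 'v set) \<Rightarrow> ('h \<Rightarrow> 'h) \<Rightarrow> ('w \<Rightarrow> 'h \<Rightarrow> 'v) \<Rightarrow> bool"
  where "continuous_star_K_g_frame M ipH ipV Hs K \<Lambda> \<longleftrightarrow>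
    (\<forall>\<omega>\<in>space M. \<Lambda> \<omega> \<in> End_star ipH ipV (Hs \<omega>)) \<and>
    (\<forall>x. (\<lambda>\<omega>. \<Lambda> \<omega> x) \<in> borel_measurable M) \<and>
    (\<forall>x. integrable_bochner M (\<lambda>\<omega>. ipV (\<Lambda> \<omega> x) (\<Lambda> \<omega> x))) \<and>
    (\<exists>A' B. strictly_nonzero A' \<and> strictly_nonzero B \<and>
      (\<forall>x. A' * ipH (adj ipH ipH K x) (adj ipH ipH K x) * star A'
             \<le>\<^sub>A integral_bochner M (\<lambda>\<omega>. ipV (\<Lambda> \<omega> x) (\<Lambda> \<omega> x)) \<and>
           integral_bochner M (\<lambda>\<omega>. ipV (\<Lambda> \<omega> x) (\<Lambda> \<omega> x)) \<le>\<^sub>A B * ipH x x * star B))"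

definition frame_operator ::
  "'w measure \<Rightarrow> ('h::banach \<Rightarrow> 'h \<Rightarrow> 'a) \<Rightarrow> ('v \<Rightarrow> 'v \<Rightarrow> 'a) \<Rightarrow> ('w \<Rightarrow> 'h \<Rightarrow> 'v) \<Rightarrow> 'h \<Rightarrow> 'h"
  where "frame_operator M ipH ipV \<Lambda> x =
    integral_bochner M (\<lambda>\<omega>. adj ipH ipV (\<Lambda> \<omega>) (\<Lambda> \<omega> x))"

end

theory Submission
  imports Defs
begin

text \<open>
  Write \<open>p x\<close> for \<open>\<integral>\<langle>\<Lambda> x, \<Lambda> x\<rangle>\<close> and \<open>q x\<close> for \<open>\<langle>K\<^sup>* x, K\<^sup>* x\<rangle>\<close>.  Since bounded linear maps commute with
  the Bochner integral, \<open>p x = \<langle>S x, x\<rangle>\<close>; hence \<open>S \<ge> A K K\<^sup>*\<close> says \<open>A q x \<le> p x\<close> for all \<open>x\<close>, while the lower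
  frame bound says \<open>A' q x A'\<^sup>* \<le> p x\<close>.  If \<open>A\<close> is given, the scalar element \<open>A' = sqrt A\<close> serves.

  For the converse, \<open>A'\<close> cannot be moved past \<open>q x\<close>, so the inequality for a single \<open>x\<close> is not enough.
  Taking norms gives \<open>norm (q x) \<le> L * norm (p x)\<close> for every \<open>x\<close>, where \<open>L\<close> is the squared norm of the
  inverse of \<open>A'\<close>.  Since \<open>p (a x) = a * p x * star a\<close>, and likewise for \<open>q\<close>, replacing \<open>x\<close> by \<open>a x\<close> yields
  \<open>norm (a * q x * star a) \<le> L * norm (a * p x * star a)\<close> for all \<open>a\<close>.  Testing with
  \<open>a = (p x + e)\<^bsup>-1/2\<^esup>\<close> recovers the order inequality \<open>q x \<le> L * p x\<close>; this is
  \<open>positive_if_norm_dominated\<close>.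

  The order facts needed for this come from an elementary theory of positivity in unital
  \<open>C\<^sup>*\<close>-algebras.  Square roots close to the identity are obtained by a contraction argument
  (\<open>sqrt_one_minus\<close>), and for commuting selfadjoint elements the norm of \<open>x\<^sup>2\<close> is at most that of
  \<open>x\<^sup>2 + y\<^sup>2\<close> (\<open>norm_square_le_norm_sum_squares\<close>).  From these two facts it follows that the norm of a
  selfadjoint element is attained on its spectrum (\<open>not_alg_invertible_one_minus_square\<close>), and
  therefore that the spectral definition of positivity agrees with a norm condition
  (\<open>cstar_positive_iff_norm_positive\<close>).
\<close>

section \<open>The involution\<close>

lemma star_0 [simp]: "star (0::'a::unital_cstar_algebra) = 0"
  using star_add[of "0::'a" 0] by simp

lemma star_minus: "star (- x :: 'a::unital_cstar_algebra) = - star x"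
  using star_add[of x "- x"] by (simp add: eq_neg_iff_add_eq_0 add.commute)

lemma star_diff: "star (x - y :: 'a::unital_cstar_algebra) = star x - star y"
  using star_add[of x "- y"] by (simp add: star_minus)

lemma star_1 [simp]: "star (1::'a::unital_cstar_algebra) = 1"
  using star_mult[of "star (1::'a)" 1] by (simp add: star_star)

lemma star_scaleR: "star (r *\<^sub>R x :: 'a::unital_cstar_algebra) = r *\<^sub>R star x"
  using star_scaleC[of "complex_of_real r" x] by (simp add: scaleC_of_real)

lemma star_of_real [simp]: "star (of_real r :: 'a::unital_cstar_algebra) = of_real r"
  by (simp add: of_real_def star_scaleR)

lemma star_power: "star (x ^ n :: 'a::unital_cstar_algebra) = star x ^ n"
  by (induction n) (simp_all add: star_mult power_commutes)

lemma norm_star [simp]: "norm (star x) = norm (x :: 'a::unital_cstar_algebra)"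
proof -
  have le: "norm y \<le> norm (star y)" for y :: 'a
  proof (cases "y = 0")
    case False
    have "norm y * norm y \<le> norm (star y) * norm y"
      using norm_mult_ineq[of "star y" y] by (simp add: norm_star_mult_self power2_eq_square)
    with False show ?thesis by simp
  qed simp
  show ?thesis using le[of x] le[of "star x"] by (simp add: star_star)
qed

lemma bounded_linear_star: "bounded_linear (star :: 'a::unital_cstar_algebra \<Rightarrow> 'a)"
  by (rule bounded_linear_intro[where K = 1]) (simp_all add: star_add star_scaleR)

lemma norm_selfadjoint_square:
  fixes x :: "'a::unital_cstar_algebra"
  assumes "star x = x" shows "norm (x * x) = (norm x)\<^sup>2"
  using norm_star_mult_self[of x] assms by simp

lemma of_real_commute: "of_real r * x = x * (of_real r :: 'a::real_algebra_1)"
  by (simp add: of_real_def)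

lemma scaleC_ii_square: "\<i> *\<^sub>C \<i> *\<^sub>C x = - (x :: 'a::unital_cstar_algebra)"
  using scaleC_of_real[of "-1" x] by (simp add: scaleC_scaleC)

lemma star_scaleC_ii: "star (\<i> *\<^sub>C x) = - (\<i> *\<^sub>C star (x :: 'a::unital_cstar_algebra))"
  using scaleC_add_left[of "\<i>" "-\<i>" "star x"] scaleC_of_real[of 0 "star x"]
  by (simp add: star_scaleC eq_neg_iff_add_eq_0 add.commute)

lemma star_inverse_selfadjoint:
  fixes c d :: "'a::unital_cstar_algebra"
  assumes "star c = c" "c * d = 1" shows "star d = d"
proof -
  have "star d = star d * (c * d)" by (simp add: assms)
  also have "\<dots> = star (c * d) * d" by (simp add: star_mult assms(1) mult.assoc)
  finally show ?thesis by (simp add: assms)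
qed

section \<open>Invertible elements of Banach algebras\<close>

lemma alg_invertible_mult:
  assumes "alg_invertible a" "alg_invertible b" shows "alg_invertible (a * b)"
proof -
  obtain a' b' where "a * a' = 1" "a' * a = 1" "b * b' = 1" "b' * b = 1"
    using assms by (auto simp: alg_invertible_def)
  then have "a * (b * b') * a' = 1" "b' * (a' * a) * b = 1" by simp_all
  then have "(a * b) * (b' * a') = 1 \<and> (b' * a') * (a * b) = 1" by (simp only: mult.assoc simp_thms)
  then show ?thesis unfolding alg_invertible_def by blast
qed

lemma alg_invertible_commuting_factor:
  assumes "alg_invertible (a * b)" "a * b = b * a" shows "alg_invertible a"
proof -
  obtain c where c: "a * b * c = 1" "c * (a * b) = 1" using assms by (auto simp: alg_invertible_def)
  have "a * (b * c) = 1" using c by (simp add: mult.assoc)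
  moreover have "(c * b) * a = 1" using c assms by (simp add: mult.assoc)
  moreover have "c * b = b * c"
  proof -
    have "c * b = (c * b) * (a * (b * c))" using c by (simp add: mult.assoc)
    also have "\<dots> = (c * b * a) * (b * c)" by (simp only: mult.assoc)
    also have "\<dots> = b * c" using c assms by (simp add: mult.assoc)
    finally show ?thesis .
  qed
  ultimately have "a * (b * c) = 1 \<and> (b * c) * a = 1" by simp
  then show ?thesis unfolding alg_invertible_def by blast
qed

lemma alg_invertible_minus_iff:
  "alg_invertible (- a) \<longleftrightarrow> alg_invertible (a::'a::ring_1)"
proof -
  have "alg_invertible (- b)" if "alg_invertible b" for b :: 'a
    using that unfolding alg_invertible_def by (metis minus_mult_minus)
  from this[of a] this[of "- a"] show ?thesis by auto
qed

lemma alg_invertible_of_real: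
  "r \<noteq> 0 \<Longrightarrow> alg_invertible (of_real r :: 'a::real_algebra_1)"
  unfolding alg_invertible_def by (intro exI[of _ "of_real (inverse r)"]) (simp flip: of_real_mult)

lemma alg_invertible_one_minus:
  fixes x :: "'a::{real_normed_algebra_1, banach}"
  assumes "norm x < 1" shows "alg_invertible (1 - x)"
proof -
  have "\<exists>!y. 1 + x * y = y"
  proof (rule banach_fix_type[OF norm_ge_zero assms], intro allI)
    fix y z show "dist (1 + x * y) (1 + x * z) \<le> norm x * dist y z"
      using norm_mult_ineq[of x "y - z"] by (simp add: dist_norm right_diff_distrib)
  qed
  moreover have "\<exists>!y. 1 + y * x = y"
  proof (rule banach_fix_type[OF norm_ge_zero assms], intro allI)
    fix y z show "dist (1 + y * x) (1 + z * x) \<le> norm x * dist y z"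
      using norm_mult_ineq[of "y - z" x] by (simp add: dist_norm left_diff_distrib mult.commute)
  qed
  ultimately obtain y z where "1 + x * y = y" "1 + z * x = z" by blast
  then have yz: "(1 - x) * y = 1" "z * (1 - x) = 1" by (simp_all add: algebra_simps)
  then have "z = z * ((1 - x) * y)" "y = (z * (1 - x)) * y" by simp_all
  then have "y = z" by (simp only: mult.assoc)
  with yz show ?thesis unfolding alg_invertible_def by blast
qed

lemma alg_invertible_of_real_minus:
  fixes x :: "'a::{real_normed_algebra_1, banach}"
  assumes "norm x < r" shows "alg_invertible (of_real r - x)"
proof -
  have r: "r > 0" using assms norm_ge_zero[of x] by linarith
  have "norm (x /\<^sub>R r) < 1" using assms r by (simp add: divide_simps)
  then have "alg_invertible (of_real r * (1 - x /\<^sub>R r))"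
    using r by (intro alg_invertible_mult alg_invertible_of_real alg_invertible_one_minus) auto
  then show ?thesis using r by (simp add: of_real_def right_diff_distrib)
qed

section \<open>Square roots and norms of sums of squares\<close>

text \<open>
  With \<open>r = 1 - b\<close> the equation \<open>r\<^sup>2 = 1 - x\<close> becomes the fixed point equation
  \<open>b = (x + b\<^sup>2) / 2\<close>, whose right-hand side is a contraction of the ball of radius
  \<open>norm x < 1\<close>.  Running it inside the closed set of selfadjoint elements that commute with
  everything commuting with \<open>x\<close> gives the last conclusion, which stands in for a functional calculus.
\<close>

lemma sqrt_one_minus:
  fixes x :: "'a::unital_cstar_algebra"
  assumes sa: "star x = x" and x: "norm x < 1"
  obtains r where "star r = r" "r * r = 1 - x" "\<And>z. z * x = x * z \<Longrightarrow> z * r = r * z"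
proof -
  let ?f = "\<lambda>b. (1/2) *\<^sub>R (x + b * b)"
  define S where "S = {b. norm b \<le> norm x} \<inter> {b. star b = b} \<inter>
    (\<Inter>z\<in>{z. z * x = x * z}. {b. z * b = b * z})"
  have "closed S" unfolding S_def
    by (intro closed_Int closed_INT ballI closed_Collect_le closed_Collect_eq continuous_intros
        bounded_linear.continuous_on[OF bounded_linear_star])
  then have "complete S" by (simp add: complete_eq_closed)
  moreover have "0 \<in> S" by (simp add: S_def)
  moreover have "?f b \<in> S" if "b \<in> S" for b
  proof -
    have b: "norm b \<le> norm x" "star b = b" and comm: "\<And>z. z * x = x * z \<Longrightarrow> z * b = b * z"
      using that by (auto simp: S_def)
    have "norm (b * b) \<le> norm x * 1"
      using norm_mult_ineq[of b b] mult_mono[OF b(1), of "norm b" 1] b x by simp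
    then have "norm (?f b) \<le> norm x" using norm_triangle_ineq[of x "b * b"] by simp
    moreover have "z * ?f b = ?f b * z" if zx: "z * x = x * z" for z
    proof -
      have "z * (b * b) = (z * b) * b" by (rule mult.assoc[symmetric])
      also have "\<dots> = b * (z * b)" by (simp only: comm[OF zx]) (simp only: mult.assoc comm[OF zx])
      also have "\<dots> = (b * b) * z" by (simp only: comm[OF zx]) (simp only: mult.assoc)
      finally have "z * (b * b) = (b * b) * z" .
      then show ?thesis using zx by (simp add: distrib_left distrib_right)
    qed
    ultimately show ?thesis by (simp add: S_def star_scaleR star_add star_mult sa b)
  qed
  moreover have "dist (?f b) (?f c) \<le> norm x * dist b c" if "b \<in> S" "c \<in> S" for b c
  proof -
    have "?f b - ?f c = (1/2) *\<^sub>R (b * (b - c) + (b - c) * c)"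
      by (simp add: algebra_simps flip: scaleR_diff_right)
    moreover have "norm (b * (b - c)) \<le> norm x * norm (b - c)"
        "norm ((b - c) * c) \<le> norm x * norm (b - c)"
      using that norm_mult_ineq[of b "b - c"] norm_mult_ineq[of "b - c" c]
        mult_right_mono[of "norm b" "norm x" "norm (b - c)"]
        mult_right_mono[of "norm c" "norm x" "norm (b - c)"]
      by (auto simp: S_def mult.commute)
    ultimately show ?thesis
      using norm_triangle_ineq[of "b * (b - c)" "(b - c) * c"] by (simp add: dist_norm)
  qed
  ultimately have "\<exists>!b. b \<in> S \<and> ?f b = b"
    using x by (intro Banach_fix[where c = "norm x"]) auto
  then obtain b where b: "b \<in> S" "?f b = b" by blast
  have "x + b * b = 2 *\<^sub>R b" using arg_cong[OF b(2), of "\<lambda>y. 2 *\<^sub>R y"] by simp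
  then have "(1 - b) * (1 - b) = 1 - x"
    by (simp add: algebra_simps scaleR_2)
  moreover have "z * (1 - b) = (1 - b) * z" if "z * x = x * z" for z
  proof -
    have "z * b = b * z" using b(1) that unfolding S_def by blast
    then show ?thesis by (simp add: right_diff_distrib left_diff_distrib)
  qed
  moreover have "star (1 - b) = 1 - b" using b(1) by (simp add: S_def star_diff)
  ultimately show ?thesis using that by blast
qed

text \<open>
  Commuting selfadjoint \<open>x\<close> and \<open>y\<close> are the real and imaginary parts of the normal element
  \<open>z = x + \<i> y\<close>.  The \<open>C\<^sup>*\<close>-identity turns \<open>star z * z = x\<^sup>2 + y\<^sup>2\<close> into
  \<open>norm (x\<^sup>2 + y\<^sup>2) = (norm z)\<^sup>2\<close>, and a real part has norm at most \<open>norm z\<close>.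
\<close>

lemma norm_square_le_norm_sum_squares:
  fixes x y :: "'a::unital_cstar_algebra"
  assumes "star x = x" "star y = y" and comm: "x * y = y * x"
  shows "norm (x * x) \<le> norm (x * x + y * y)"
proof -
  define w where "w = \<i> *\<^sub>C y"
  have sw: "star w = - w" by (simp add: w_def star_scaleC_ii assms)
  have ww: "w * w = - (y * y)"
    by (simp add: w_def mult_scaleC_left mult_scaleC_right scaleC_ii_square)
  have xw: "w * x = x * w" by (simp add: w_def mult_scaleC_left mult_scaleC_right comm)
  define z where "z = x + w"
  have sz: "star z = x - w" by (simp add: z_def star_add sw assms)
  have "star z * z = x * x + y * y" unfolding sz by (simp add: z_def algebra_simps ww xw)
  then have "norm (x * x + y * y) = (norm z)\<^sup>2" using norm_star_mult_self[of z] by simp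
  moreover have "2 * norm x \<le> 2 * norm z"
  proof -
    have "2 *\<^sub>R x = z + star z" unfolding sz by (simp add: z_def scaleR_2)
    then have "norm (2 *\<^sub>R x) \<le> norm z + norm (star z)" by (metis norm_triangle_ineq)
    then show ?thesis by simp
  qed
  ultimately show ?thesis using assms by (simp add: norm_selfadjoint_square power_mono)
qed

section \<open>Positivity as a norm condition\<close>

text \<open>
  For a real function \<open>a\<close> on a compact space the norm condition says \<open>0 \<le> a \<le> 2 t\<close>.  Stated through
  the norm, positivity passes to sums by the triangle inequality and forces \<open>a + e\<close> to have a square
  root for every \<open>e > 0\<close>; neither is visible from the spectrum.
\<close>

definition norm_positive :: "'a::unital_cstar_algebra \<Rightarrow> bool"
  where "norm_positive a \<longleftrightarrow> star a = a \<and> (\<exists>t\<ge>0. norm (of_real t - a) \<le> t)"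

lemma norm_positive_selfadjoint: "norm_positive a \<Longrightarrow> star a = a"
  by (simp add: norm_positive_def)

lemma norm_positive_of_real_minus:
  assumes "star x = x" "norm x \<le> t" shows "norm_positive (of_real t - x)"
  using assms order_trans[OF norm_ge_zero assms(2)] unfolding norm_positive_def
  by (auto simp: star_diff intro!: exI[of _ t])

lemma norm_positive_add:
  assumes "norm_positive a" "norm_positive b" shows "norm_positive (a + b)"
proof -
  obtain s t where st: "s \<ge> 0" "t \<ge> 0" "norm (of_real s - a) \<le> s" "norm (of_real t - b) \<le> t"
    using assms by (auto simp: norm_positive_def)
  have "norm (of_real (s + t) - (a + b)) \<le> s + t"
    using norm_triangle_ineq[of "of_real s - a" "of_real t - b"] st by (simp add: algebra_simps)
  then show ?thesis
    using st(1,2) assms unfolding norm_positive_def by (auto simp: star_add intro!: exI[of _ "s + t"])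
qed

lemma norm_positive_scaleR:
  assumes "norm_positive a" "r \<ge> 0" shows "norm_positive (r *\<^sub>R a)"
proof -
  obtain t where t: "t \<ge> 0" "norm (of_real t - a) \<le> t"
    using assms by (auto simp: norm_positive_def)
  have "of_real (r * t) - r *\<^sub>R a = r *\<^sub>R (of_real t - a)"
    by (simp add: of_real_def scaleR_right_diff_distrib)
  then have "norm (of_real (r * t) - r *\<^sub>R a) \<le> r * t"
    using t assms by (simp add: mult_left_mono)
  then show ?thesis using t assms unfolding norm_positive_def
    by (auto simp: star_scaleR intro!: exI[of _ "r * t"])
qed

lemma norm_positive_0 [simp]: "norm_positive 0"
  by (auto simp: norm_positive_def)

lemma norm_positive_sum:
  "(\<And>i. i \<in> I \<Longrightarrow> norm_positive (f i)) \<Longrightarrow> norm_positive (sum f I)"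
  by (induction I rule: infinite_finite_induct) (auto intro: norm_positive_add)

lemma sqrt_positive_plus_of_real:
  assumes y: "norm_positive y" and e: "e > 0"
  obtains r where "star r = r" "r * r = y + of_real e" "\<And>z. z * y = y * z \<Longrightarrow> z * r = r * z"
proof -
  obtain t where t: "t \<ge> 0" "norm (of_real t - y) \<le> t" using y by (auto simp: norm_positive_def)
  define s where "s = t + e"
  have s: "s > 0" using t e by (simp add: s_def)
  define x where "x = (1 / s) *\<^sub>R (of_real t - y)"
  have "star x = x" using y by (simp add: x_def star_scaleR star_diff norm_positive_def)
  moreover have "norm x < 1" using t e s by (simp add: x_def divide_simps s_def)
  ultimately obtain r where r: "star r = r" "r * r = 1 - x" "\<And>z. z * x = x * z \<Longrightarrow> z * r = r * z"
    using sqrt_one_minus by blast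
  show ?thesis
  proof
    show "star (sqrt s *\<^sub>R r) = sqrt s *\<^sub>R r" using r(1) by (simp add: star_scaleR)
    have "s *\<^sub>R x = of_real t - y" using s by (simp add: x_def)
    then show "(sqrt s *\<^sub>R r) * (sqrt s *\<^sub>R r) = y + of_real e"
      using s r(2) by (simp add: scaleR_right_diff_distrib) (simp add: s_def of_real_def scaleR_add_left)
    fix z assume "z * y = y * z"
    then have "z * x = x * z"
      by (simp add: x_def right_diff_distrib left_diff_distrib of_real_def)
    then show "z * (sqrt s *\<^sub>R r) = (sqrt s *\<^sub>R r) * z" using r(3) by simp
  qed
qed

text \<open>
  If \<open>norm y < 1\<close> then \<open>1 - y\<^sup>2 = r\<^sup>2\<close> for some \<open>r\<close> commuting with \<open>y\<close>, so
  \<open>norm (1 - y\<^sup>2) = norm (r\<^sup>2) \<le> norm (r\<^sup>2 + y\<^sup>2) = 1\<close>.  The general case is a rescaling of this.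
\<close>

lemma norm_positive_square:
  assumes "star x = x" shows "norm_positive (x * x)"
proof -
  define s where "s = (norm x)\<^sup>2 + 1"
  have s: "s > 0" by (simp add: s_def add_nonneg_pos)
  define y where "y = (1 / sqrt s) *\<^sub>R x"
  have yy: "y * y = (1 / s) *\<^sub>R (x * x)" using s by (simp add: y_def)
  have sy: "star y = y" using assms by (simp add: y_def star_scaleR)
  have "norm (y * y) < 1"
    using s assms by (simp add: yy norm_selfadjoint_square divide_simps) (simp add: s_def)
  moreover have "star (y * y) = y * y" by (simp add: star_mult sy)
  ultimately obtain r where r: "star r = r" "r * r = 1 - y * y"
      "\<And>z. z * (y * y) = y * y * z \<Longrightarrow> z * r = r * z"
    using sqrt_one_minus by blast
  have "r * y = y * r" using r(3)[of y] by (simp add: mult.assoc)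
  from norm_square_le_norm_sum_squares[OF r(1) sy this] have "norm (1 - y * y) \<le> 1"
    by (simp add: r(2))
  moreover have "of_real s - x * x = s *\<^sub>R (1 - y * y)"
    using s by (simp add: yy of_real_def scaleR_right_diff_distrib)
  ultimately have "norm (of_real s - x * x) \<le> s"
    using s mult_left_mono[of "norm (1 - y * y)" 1 s] by simp
  then show ?thesis
    using s assms unfolding norm_positive_def by (auto simp: star_mult intro!: exI[of _ s])
qed

text \<open>
  Up to a small multiple of the identity, both summands are squares of commuting selfadjoint elements.
\<close>

lemma norm_le_norm_add_positive:
  assumes y: "norm_positive y" and z: "norm_positive z" and comm: "y * z = z * y"
  shows "norm y \<le> norm (y + z)"
proof (rule field_le_epsilon)
  fix e :: real assume "e > 0"
  define d where "d = e / 3"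
  have d: "d > 0" using \<open>e > 0\<close> by (simp add: d_def)
  obtain r where r: "star r = r" "r * r = y + of_real d" "\<And>w. w * y = y * w \<Longrightarrow> w * r = r * w"
    using sqrt_positive_plus_of_real[OF y d] by blast
  obtain q where q: "star q = q" "q * q = z + of_real d" "\<And>w. w * z = z * w \<Longrightarrow> w * q = q * w"
    using sqrt_positive_plus_of_real[OF z d] by blast
  have "r * q = q * r" using r(3)[of z] q(3)[of r] comm by simp
  from norm_square_le_norm_sum_squares[OF r(1) q(1) this]
  moreover have "of_real (2 * d) = of_real d + (of_real d :: 'a)" by (simp flip: of_real_add)
  ultimately have *: "norm (y + of_real d) \<le> norm ((y + z) + of_real (2 * d))"
    by (simp only: r(2) q(2) add_ac)
  have "norm y \<le> norm (y + of_real d) + d"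
    using norm_triangle_ineq4[of "y + of_real d" "of_real d"] d by simp
  also note *
  also have "norm ((y + z) + of_real (2 * d)) \<le> norm (y + z) + norm (of_real (2 * d) :: 'a)"
    by (rule norm_triangle_ineq)
  also have "norm (of_real (2 * d) :: 'a) = 2 * d" using d by (subst norm_of_real) simp
  finally show "norm y \<le> norm (y + z) + e" by (simp add: d_def)
qed

text \<open>
  The element is \<open>(t + e) - (t - y)\<close> with \<open>norm (t - y) \<le> t < t + e\<close>.
\<close>

lemma alg_invertible_positive_plus_of_real:
  assumes "norm_positive y" "e > 0" shows "alg_invertible (y + of_real e)"
proof -
  obtain t where t: "norm (of_real t - y) \<le> t" using assms by (auto simp: norm_positive_def)
  then have "alg_invertible (of_real (t + e) - (of_real t - y))"
    using assms by (intro alg_invertible_of_real_minus) simp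
  then show ?thesis by (simp add: add.commute)
qed

section \<open>Positivity as a spectral condition\<close>

lemma norm_power_selfadjoint:
  fixes h :: "'a::unital_cstar_algebra"
  assumes "star h = h" shows "norm (h ^ (2 ^ m)) = norm h ^ (2 ^ m)"
proof (induction m)
  case (Suc m)
  have "h ^ (2 ^ Suc m) = h ^ (2 ^ m) * h ^ (2 ^ m)" by (simp add: mult_2 power_add)
  moreover have "star (h ^ (2 ^ m)) = h ^ (2 ^ m)" by (simp add: star_power assms)
  ultimately show ?case
    by (simp add: norm_selfadjoint_square Suc mult.commute flip: power_mult)
qed simp

text \<open>
  This says that the norm of a selfadjoint element is its spectral radius, because one of \<open>1 - h\<close> and
  \<open>1 + h\<close> must then fail to be invertible.  The reason is a conflict between two estimates of the
  partial geometric sums \<open>D n\<close> of \<open>h\<^sup>2\<close>.  If \<open>1 - h\<^sup>2\<close> had an inverse, the telescoping identity would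
  bound them independently of \<open>n\<close>.  On the other hand \<open>2 D n\<close> is \<open>n h\<^bsup>2n\<^esup>\<close> plus the squares
  \<open>2 h\<^bsup>2j\<^esup> - h\<^bsup>2n\<^esup>\<close>, so its norm is at least \<open>n (norm (h\<^bsup>n\<^esup>))\<^sup>2\<close>, which is \<open>n\<close> for every power of two.
\<close>

lemma not_alg_invertible_one_minus_square:
  fixes h :: "'a::unital_cstar_algebra"
  assumes sa: "star h = h" and h: "norm h = 1"
  shows "\<not> alg_invertible (1 - h * h)"
proof
  assume "alg_invertible (1 - h * h)"
  then obtain d where d: "d * (1 - h * h) = 1" by (auto simp: alg_invertible_def)
  define D where "D n = (\<Sum>j<n. h ^ j * h ^ j)" for n
  have tele: "(1 - h * h) * D n = 1 - h ^ n * h ^ n" for n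
  proof (induction n)
    case (Suc n)
    have "h * h * (h ^ n * h ^ n) = h ^ (1 + 1 + (n + n))" by (simp only: power_add power_one_right)
    also have "\<dots> = h ^ (Suc n + Suc n)" by simp
    also have "\<dots> = h ^ Suc n * h ^ Suc n" by (rule power_add)
    finally have "h * h * (h ^ n * h ^ n) = h ^ Suc n * h ^ Suc n" .
    with Suc show ?case by (simp add: D_def distrib_left left_diff_distrib)
  qed (simp add: D_def)
  have bound: "real (2 ^ m) \<le> 4 * norm d" for m
  proof -
    define n :: nat where "n = 2 ^ m"
    have hn: "norm (h ^ n) = 1" using norm_power_selfadjoint[OF sa, of m] h by (simp add: n_def)
    have shn: "star (h ^ j) = h ^ j" for j by (simp add: star_power sa)
    have "D n = d * (1 - h * h) * D n" by (simp add: d)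
    also have "\<dots> = d * (1 - h ^ n * h ^ n)" by (simp only: mult.assoc tele)
    finally have "D n = d * (1 - h ^ n * h ^ n)" .
    then have "norm (D n) \<le> norm d * norm (1 - h ^ n * h ^ n)" by (simp add: norm_mult_ineq)
    also have "\<dots> \<le> norm d * 2"
      using norm_triangle_ineq4[of 1 "h ^ n * h ^ n"] norm_selfadjoint_square[OF shn[of n]] hn
      by (intro mult_left_mono) auto
    finally have upper: "norm (D n) \<le> norm d * 2" .
    have sq: "norm_positive (2 *\<^sub>R (h ^ j * h ^ j) - h ^ n * h ^ n)" if "j < n" for j
    proof -
      define k where "k = h ^ (n - j) * h ^ (n - j)"
      have "norm k \<le> 1"
        unfolding k_def norm_selfadjoint_square[OF shn]
        using norm_power_ineq[of h "n - j"] h by (simp add: power_le_one)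
      then have "norm_positive (of_real 1 - k)"
        by (intro norm_positive_of_real_minus) (simp_all add: k_def star_mult shn)
      from sqrt_positive_plus_of_real[OF this zero_less_one] obtain r where r: "star r = r" "r * r = of_real 1 - k + of_real 1"
          "\<And>z. z * (of_real 1 - k) = (of_real 1 - k) * z \<Longrightarrow> z * r = r * z"
        by blast
      have rr: "r * r = 2 - k" using r(2) by simp
      have "h ^ j * k = k * h ^ j" by (simp add: k_def add.commute flip: power_add)
      then have c: "h ^ j * r = r * h ^ j" by (intro r(3)) (simp add: right_diff_distrib left_diff_distrib)
      have "norm_positive ((h ^ j * r) * (h ^ j * r))"
        by (rule norm_positive_square) (simp add: star_mult shn r(1) c)
      also have "(h ^ j * r) * (h ^ j * r) = h ^ j * (r * r) * h ^ j"
        by (subst (2) c) (simp only: mult.assoc)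
      also have "\<dots> = 2 *\<^sub>R (h ^ j * h ^ j) - h ^ j * k * h ^ j"
        by (simp add: rr right_diff_distrib left_diff_distrib scaleR_2 mult_2_right distrib_right)
      also have "h ^ j * k * h ^ j = h ^ n * h ^ n"
        using that by (simp add: k_def flip: power_add)
      finally show ?thesis .
    qed
    let ?S = "\<Sum>j<n. 2 *\<^sub>R (h ^ j * h ^ j) - h ^ n * h ^ n"
    have "norm (real n *\<^sub>R (h ^ n * h ^ n)) \<le> norm (real n *\<^sub>R (h ^ n * h ^ n) + ?S)"
    proof (rule norm_le_norm_add_positive)
      show "norm_positive (real n *\<^sub>R (h ^ n * h ^ n))"
        by (intro norm_positive_scaleR norm_positive_square shn) simp
      show "norm_positive ?S" by (intro norm_positive_sum sq) simp
      have "(h ^ n * h ^ n) * ?S = ?S * (h ^ n * h ^ n)"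
        by (simp add: sum_distrib_left sum_distrib_right right_diff_distrib left_diff_distrib
            add.commute flip: power_add)
      then show "real n *\<^sub>R (h ^ n * h ^ n) * ?S = ?S * real n *\<^sub>R (h ^ n * h ^ n)" by simp
    qed
    moreover have "real n *\<^sub>R (h ^ n * h ^ n) + ?S = 2 *\<^sub>R D n"
      by (simp add: D_def sum_subtractf scaleR_sum_right sum_distrib_left scaleR_conv_of_real)
    ultimately have "real n \<le> 2 * norm (D n)"
      using norm_selfadjoint_square[OF shn[of n]] hn by simp
    with upper show ?thesis by (simp add: n_def)
  qed
  obtain m where "4 * norm d < 2 ^ m" using real_arch_pow[of 2 "4 * norm d"] by auto
  with bound[of m] show False by simp
qed

text \<open>
  With \<open>t = norm a\<close> and \<open>h = t - a\<close>, failure of positivity means \<open>N = norm h > t\<close>.  Since \<open>N\<close> or \<open>- N\<close>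
  is in the spectrum of \<open>h\<close>, the spectrum of \<open>a\<close> contains \<open>t - N < 0\<close> or \<open>t + N > norm a\<close>; the first
  is excluded by hypothesis, the second by the Neumann series.
\<close>

lemma norm_positive_if_alg_invertible:
  assumes sa: "star a = a" and inv: "\<And>t. t > 0 \<Longrightarrow> alg_invertible (a + of_real t)"
  shows "norm_positive a"
proof (rule ccontr)
  assume "\<not> norm_positive a"
  define t where "t = norm a"
  define h where "h = of_real t - a"
  define N where "N = norm h"
  have t: "t \<ge> 0" by (simp add: t_def)
  have N: "N > t" using \<open>\<not> norm_positive a\<close> sa t
    unfolding N_def h_def norm_positive_def by (meson not_le)
  have "alg_invertible (of_real N - h)"
    using inv[of "N - t"] N by (simp add: h_def algebra_simps)
  moreover have "alg_invertible (of_real (N + t) - a)"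
    using N t unfolding t_def by (intro alg_invertible_of_real_minus) linarith
  then have "alg_invertible (of_real N + h)" by (simp add: h_def algebra_simps)
  ultimately have "alg_invertible (of_real (1 / N) * (of_real N - h) * (of_real (1 / N) * (of_real N + h)))"
    using N t by (intro alg_invertible_mult alg_invertible_of_real) auto
  moreover define g where "g = (1 / N) *\<^sub>R h"
  have "of_real (1 / N) * (of_real N - h) = 1 - g" "of_real (1 / N) * (of_real N + h) = 1 + g"
    using N t by (simp_all add: g_def of_real_def right_diff_distrib distrib_left)
  ultimately have "alg_invertible ((1 - g) * (1 + g))" by simp
  also have "(1 - g) * (1 + g) = 1 - g * g" by (simp add: algebra_simps)
  finally have "alg_invertible (1 - g * g)" .
  moreover have "star g = g" by (simp add: g_def h_def star_scaleR star_diff sa)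
  moreover have "norm g = 1" using N t by (simp add: g_def flip: N_def)
  ultimately show False using not_alg_invertible_one_minus_square by blast
qed

lemma cstar_positive_iff_norm_positive: "cstar_positive a \<longleftrightarrow> norm_positive a"
proof
  assume a: "cstar_positive a"
  show "norm_positive a"
  proof (rule norm_positive_if_alg_invertible)
    show "star a = a" using a by (simp add: cstar_positive_def)
    fix t :: real assume "t > 0"
    then have "complex_of_real (- t) \<notin> complex_of_real ` {0..}"
      by (auto simp del: of_real_minus)
    with a have "alg_invertible (complex_of_real (- t) *\<^sub>C 1 - a)"
      by (auto simp: cstar_positive_def spectrum_def)
    also have "complex_of_real (- t) *\<^sub>C 1 - a = - (a + of_real t)"
      unfolding scaleC_of_real by (simp add: of_real_def)
    finally show "alg_invertible (a + of_real t)" by (simp only: alg_invertible_minus_iff)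
  qed
next
  assume a: "norm_positive a"
  have sa: "star a = a" using a by (rule norm_positive_selfadjoint)
  have "c \<in> complex_of_real ` {0..}" if "\<not> alg_invertible (c *\<^sub>C 1 - a)" for c
  proof (rule ccontr)
    assume c: "c \<notin> complex_of_real ` {0..}"
    \<comment> \<open>For non-real \<open>c\<close> the product \<open>(u + v) (u - v)\<close> is a square plus a positive number.\<close>
    define u v where "u = of_real (Re c) - a" and "v = \<i> *\<^sub>C (of_real (Im c) :: 'a)"
    have "c *\<^sub>C 1 = of_real (Re c) + v"
    proof -
      have "c = complex_of_real (Re c) + \<i> * complex_of_real (Im c)" by (rule complex_eq)
      then have "c *\<^sub>C (1::'a) = (complex_of_real (Re c) + \<i> * complex_of_real (Im c)) *\<^sub>C 1" by simp
      also have "\<dots> = Re c *\<^sub>R 1 + \<i> *\<^sub>C Im c *\<^sub>R 1"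
        by (simp only: scaleC_add_left scaleC_of_real flip: scaleC_scaleC)
      finally show ?thesis by (simp add: v_def of_real_def)
    qed
    then have cuv: "c *\<^sub>C 1 - a = u + v" by (simp add: u_def)
    show False
    proof (cases "Im c = 0")
      case True
      with c have "- Re c > 0" by (auto simp: image_iff complex_eq_iff not_le)
      from alg_invertible_positive_plus_of_real[OF a this]
      have "alg_invertible (- u)" by (simp add: u_def)
      moreover have "v = 0" using True scaleC_of_real[of 0 "0::'a"] scaleC_add_right[of \<i> "0::'a" 0]
        by (simp add: v_def)
      ultimately show False using that cuv by (simp add: alg_invertible_minus_iff)
    next
      case False
      have vv: "v * v = - of_real ((Im c)\<^sup>2)"
        by (simp add: v_def mult_scaleC_left mult_scaleC_right scaleC_ii_square power2_eq_square)
      have uv: "u * v = v * u"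
        by (simp add: v_def mult_scaleC_left mult_scaleC_right of_real_commute)
      have "alg_invertible (u * u + of_real ((Im c)\<^sup>2))"
        using False
        by (intro alg_invertible_positive_plus_of_real norm_positive_square)
          (auto simp: u_def star_diff sa)
      also have "u * u + of_real ((Im c)\<^sup>2) = (u + v) * (u - v)"
        by (simp add: distrib_right right_diff_distrib vv uv)
      finally have "alg_invertible (u + v)"
        by (rule alg_invertible_commuting_factor)
           (simp add: distrib_left distrib_right right_diff_distrib left_diff_distrib uv)
      then show False using that cuv by simp
    qed
  qed
  then show "cstar_positive a"
    using sa by (auto simp: cstar_positive_def spectrum_def)
qed

text \<open>
  For \<open>t > 0\<close> one has \<open>c y c + t = c (y + t d\<^sup>2) c\<close>, and \<open>d\<^sup>2\<close> is a square plus some \<open>\<delta> > 0\<close>.  The middle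
  factor is therefore positive plus a positive number, hence invertible.
\<close>

lemma norm_positive_congruence:
  assumes y: "norm_positive y" and c: "star c = c" and cd: "c * d = 1" "d * c = 1"
  shows "norm_positive (c * y * c)"
proof (rule norm_positive_if_alg_invertible)
  show "star (c * y * c) = c * y * c"
    using norm_positive_selfadjoint[OF y] by (simp add: star_mult c mult.assoc)
  fix t :: real assume t: "t > 0"
  have d: "star d = d" using c cd(1) by (rule star_inverse_selfadjoint)
  define \<delta> where "\<delta> = 1 / (norm (c * c) + 1)"
  have \<delta>: "\<delta> > 0" by (simp add: \<delta>_def add_nonneg_pos)
  have "norm (\<delta> *\<^sub>R (c * c)) < 1"
    by (simp add: \<delta>_def divide_simps add_nonneg_pos)
  moreover have "star (\<delta> *\<^sub>R (c * c)) = \<delta> *\<^sub>R (c * c)" by (simp add: star_scaleR star_mult c)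
  ultimately obtain s where s: "star s = s" "s * s = 1 - \<delta> *\<^sub>R (c * c)"
      "\<And>z. z * (\<delta> *\<^sub>R (c * c)) = \<delta> *\<^sub>R (c * c) * z \<Longrightarrow> z * s = s * z"
    using sqrt_one_minus by blast
  have dcc: "d * (c * c) = c" using cd by (simp flip: mult.assoc)
  have ccd: "(c * c) * d = c" using cd by (simp add: mult.assoc)
  have ds: "d * s = s * d" by (rule s(3)) (simp add: dcc ccd)
  have dd: "(d * s) * (d * s) + of_real \<delta> = d * d"
  proof -
    have "(d * s) * (d * s) = d * (s * s) * d" by (subst (2) ds) (simp only: mult.assoc)
    also have "\<dots> = d * d - \<delta> *\<^sub>R (d * (c * c) * d)"
      unfolding s(2) by (simp add: right_diff_distrib left_diff_distrib)
    also have "d * (c * c) * d = 1" by (simp add: dcc cd)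
    finally show ?thesis by (simp add: of_real_def)
  qed
  have "norm_positive (y + t *\<^sub>R ((d * s) * (d * s)))"
    using t by (intro norm_positive_add norm_positive_scaleR norm_positive_square y)
      (auto simp: star_mult d s(1) ds)
  then have "alg_invertible (y + t *\<^sub>R ((d * s) * (d * s)) + of_real (t * \<delta>))"
    using t \<delta> by (intro alg_invertible_positive_plus_of_real) simp_all
  also have "y + t *\<^sub>R ((d * s) * (d * s)) + of_real (t * \<delta>) = y + t *\<^sub>R (d * d)"
    unfolding dd[symmetric] by (simp add: scaleR_add_right of_real_def)
  finally have "alg_invertible (c * (y + t *\<^sub>R (d * d)) * c)"
    using cd by (intro alg_invertible_mult) (auto simp: alg_invertible_def)
  also have "c * (y + t *\<^sub>R (d * d)) * c = c * y * c + t *\<^sub>R ((c * d) * (d * c))"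
    by (simp only: distrib_left distrib_right mult.assoc mult_scaleR_left mult_scaleR_right)
  finally show "alg_invertible (c * y * c + of_real t)" by (simp add: cd of_real_def)
qed

lemma norm_mono_positive:
  assumes a: "norm_positive a" and ba: "norm_positive (b - a)"
  shows "norm a \<le> norm b"
proof -
  define \<beta> where "\<beta> = norm b"
  have "star b = b"
    using norm_positive_selfadjoint[OF norm_positive_add[OF a ba]] by simp
  then have "norm_positive (of_real \<beta> - b)"
    by (rule norm_positive_of_real_minus) (simp add: \<beta>_def)
  from norm_positive_add[OF this ba] have "norm_positive (of_real \<beta> - a)" by simp
  from norm_le_norm_add_positive[OF a this] have "norm a \<le> norm (of_real \<beta> :: 'a)"
    by (simp add: right_diff_distrib left_diff_distrib of_real_commute)
  then show ?thesis by (simp add: \<beta>_def)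
qed

text \<open>
  This passes from norms to the order of the algebra.  The test element is \<open>a = d = (p + e)\<^bsup>-1/2\<^esup>\<close>, for
  which \<open>d p d = 1 - e d\<^sup>2 \<le> 1\<close>.  The hypothesis then gives \<open>d q d \<le> L\<close>, and congruence with \<open>c = d\<^bsup>-1\<^esup>\<close>
  gives \<open>q \<le> L (p + e)\<close>.  Letting \<open>e\<close> tend to \<open>0\<close> amounts to choosing \<open>L e < t\<close> below.
\<close>

lemma positive_if_norm_dominated:
  assumes p: "norm_positive p" and q: "star q = q" and L: "L \<ge> 0"
    and dom: "\<And>a. star a = a \<Longrightarrow> norm (a * q * a) \<le> L * norm (a * p * a)"
  shows "norm_positive (L *\<^sub>R p - q)"
proof (rule norm_positive_if_alg_invertible)
  show "star (L *\<^sub>R p - q) = L *\<^sub>R p - q"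
    using norm_positive_selfadjoint[OF p] q by (simp add: star_diff star_scaleR)
  fix t :: real assume t: "t > 0"
  define e where "e = t / (L + 1)"
  have e: "e > 0" using t L by (simp add: e_def)
  have te: "t - L * e > 0" using t L by (simp add: e_def field_simps)
  obtain c where c: "star c = c" "c * c = p + of_real e"
    using sqrt_positive_plus_of_real[OF p e] by blast
  have "alg_invertible (c * c)"
    unfolding c(2) by (rule alg_invertible_positive_plus_of_real[OF p e])
  then have "alg_invertible c" by (rule alg_invertible_commuting_factor) simp
  then obtain d where d: "c * d = 1" "d * c = 1" by (auto simp: alg_invertible_def)
  have sd: "star d = d" using c(1) d(1) by (rule star_inverse_selfadjoint)
  have "norm_positive (d * p * d)" by (rule norm_positive_congruence[OF p sd d(2) d(1)])
  moreover have "1 - d * p * d = e *\<^sub>R (d * d)"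
  proof -
    have "d * p * d + e *\<^sub>R (d * d) = d * (c * c) * d"
      unfolding c(2) by (simp add: distrib_left distrib_right of_real_def)
    also have "\<dots> = (d * c) * (c * d)" by (simp only: mult.assoc)
    finally show ?thesis by (simp add: d algebra_simps)
  qed
  then have "norm_positive (1 - d * p * d)"
    using e norm_positive_square[OF sd] by (simp add: norm_positive_scaleR)
  ultimately have "norm (d * p * d) \<le> 1" using norm_mono_positive[of "d * p * d" 1] by simp
  then have "norm (d * q * d) \<le> L"
    using dom[OF sd] L mult_left_mono[of "norm (d * p * d)" 1 L] by simp
  then have "norm_positive (of_real L - d * q * d)"
    by (intro norm_positive_of_real_minus) (simp_all add: star_mult sd q mult.assoc)
  then have "norm_positive (c * (of_real L - d * q * d) * c)"
    by (rule norm_positive_congruence[OF _ c(1) d])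
  also have "c * (of_real L - d * q * d) * c = L *\<^sub>R (c * c) - (c * d) * q * (d * c)"
    by (simp only: right_diff_distrib left_diff_distrib mult.assoc of_real_def
        mult_scaleR_left mult_scaleR_right mult_1_left)
  also have "\<dots> = L *\<^sub>R p - q + of_real (L * e)"
    by (simp add: d c(2) scaleR_add_right of_real_def)
  finally have "alg_invertible (L *\<^sub>R p - q + of_real (L * e) + of_real (t - L * e))"
    using te by (rule alg_invertible_positive_plus_of_real)
  then show "alg_invertible (L *\<^sub>R p - q + of_real t)" by simp
qed

section \<open>Hilbert modules and adjoints\<close>

context hilbert_module
begin

lemma ip_scaleR_left: "ip (r *\<^sub>R x) y = r *\<^sub>R ip x y"
  using ip_act_left[of "of_real r" x y] unfolding act_of_real by (simp add: of_real_def)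

lemma ip_diff_left: "ip (x - y) z = ip x z - ip y z"
  using ip_add_left[of "x - y" y z] by simp

lemma ip_add_right: "ip x (y + z) = ip x y + ip x z"
  using ip_star[of x "y + z"] ip_star[of x y] ip_star[of x z] by (simp add: ip_add_left star_add)

lemma ip_diff_right: "ip x (y - z) = ip x y - ip x z"
  using ip_add_right[of x "y - z" z] by simp

lemma ip_act_right: "ip x (act a y) = ip x y * star a"
  using ip_star[of x "act a y"] ip_star[of x y] by (simp add: ip_act_left star_mult)

lemma norm_ip_self: "norm (ip x x) = (norm x)\<^sup>2"
  by (simp add: norm_eq)

lemma norm_positive_ip_self: "norm_positive (ip x x)"
  using ip_positive cstar_positive_iff_norm_positive by blast

lemma eq_if_ip_eq: "(\<And>x. ip x z = ip x w) \<Longrightarrow> z = w"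
  using ip_definite[of "z - w"] ip_diff_right[of "z - w" z w] by simp

text \<open>
  A weak form of the Cauchy-Schwarz inequality, sufficient for continuity.  It follows from the
  triangle inequality of the module norm: that norm bounds the symmetric part \<open>ip u v + ip v u\<close>
  of the inner product, and replacing \<open>u\<close> by \<open>\<i> u\<close> recovers \<open>ip u v\<close> itself.
\<close>

lemma norm_ip_le:
  "norm (ip x y) \<le> 6 * norm x * norm y"
proof -
  have sym: "norm (ip u v + ip v u) \<le> 6" if "norm u = 1" "norm v = 1" for u v
  proof -
    have "ip u v + ip v u = ip (u + v) (u + v) - (ip u u + ip v v)"
      by (simp add: ip_add_left ip_add_right)
    then have "norm (ip u v + ip v u) \<le> norm (ip (u + v) (u + v)) + norm (ip u u + ip v v)"
      by (simp only: norm_triangle_ineq4)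
    moreover have "norm (ip u u + ip v v) \<le> 2"
      using norm_triangle_ineq[of "ip u u" "ip v v"] that by (simp add: norm_ip_self)
    moreover have "(norm (u + v))\<^sup>2 \<le> 2\<^sup>2"
      using norm_triangle_ineq[of u v] that by (intro power_mono) auto
    ultimately show ?thesis by (simp add: norm_ip_self)
  qed
  have unit: "norm (ip u v) \<le> 6" if uv: "norm u = 1" "norm v = 1" for u v
  proof -
    define j where "j = \<i> *\<^sub>C (1::'a)"
    have jj: "j * (j * z) = - z" for z
      by (simp add: j_def mult_scaleC_left scaleC_ii_square)
    have sj: "star j = - j" by (simp add: j_def star_scaleC_ii)
    have nj: "norm (j * z) = norm z" for z by (simp add: j_def mult_scaleC_left norm_scaleC)
    have "norm (ip (act j u) (act j u)) = norm (ip u u)"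
    proof -
      have "ip (act j u) (act j u) = - (j * (ip u u * j))"
        by (simp add: ip_act_left ip_act_right sj mult.assoc)
      also have "ip u u * j = j * ip u u" by (simp add: j_def mult_scaleC_left mult_scaleC_right)
      finally show ?thesis by (simp add: jj)
    qed
    then have ju: "norm (act j u) = 1" using uv by (simp add: norm_eq)
    have "ip v u * j = j * ip v u" by (simp add: j_def mult_scaleC_left mult_scaleC_right)
    then have "2 *\<^sub>R ip u v = (ip u v + ip v u) - j * (ip (act j u) v + ip v (act j u))"
      by (simp add: ip_act_left ip_act_right sj right_diff_distrib jj scaleR_2)
    then have "norm (2 *\<^sub>R ip u v) \<le> norm (ip u v + ip v u) + norm (j * (ip (act j u) v + ip v (act j u)))"
      by (simp only: norm_triangle_ineq4)
    then have "norm (2 *\<^sub>R ip u v) \<le> 6 + 6"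
      using sym[OF uv] sym[OF ju uv(2)] unfolding nj by linarith
    then show ?thesis by simp
  qed
  show ?thesis
  proof (cases "x = 0 \<or> y = 0")
    case True
    have "ip 0 y = 0" "ip x 0 = 0" using ip_diff_left[of 0 0 y] ip_diff_right[of x 0 0] by simp_all
    with True show ?thesis by auto
  next
    case False
    have right: "ip u (r *\<^sub>R v) = r *\<^sub>R ip u v" for u v r
      using ip_star[of u "r *\<^sub>R v"] ip_star[of u v] by (simp add: ip_scaleR_left star_scaleR)
    have "norm x * norm y * (inverse (norm y) * inverse (norm x)) = 1"
      using False by (simp add: field_simps)
    then have "ip x y = (norm x * norm y) *\<^sub>R ip (x /\<^sub>R norm x) (y /\<^sub>R norm y)"
      by (simp add: right ip_scaleR_left)
    then have "norm (ip x y) = (norm x * norm y) * norm (ip (x /\<^sub>R norm x) (y /\<^sub>R norm y))"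
      by (metis abs_of_nonneg mult_nonneg_nonneg norm_ge_zero norm_scaleR)
    also have "\<dots> \<le> (norm x * norm y) * 6"
      using False by (intro mult_left_mono unit) simp_all
    finally show ?thesis by (simp add: mult_ac)
  qed
qed

lemma bounded_linear_ip_left: "bounded_linear (\<lambda>y. ip y x)"
  using norm_ip_le[of _ x]
  by (intro bounded_linear_intro[where K = "6 * norm x"])
     (simp_all add: ip_add_left ip_scaleR_left mult_ac)

end

lemma ip_adj:
  assumes H: "hilbert_module actH ipH" and T: "T \<in> End_star ipH ipV W" and y: "y \<in> W"
  shows "ipV (T x) y = ipH x (adj ipH ipV T y)"
proof -
  obtain T' where T': "\<And>x. ipV (T x) y = ipH x (T' y)"
    using T y by (auto simp: End_star_def)
  have "\<forall>x. ipV (T x) y = ipH x (adj ipH ipV T y)"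
    unfolding adj_def
  proof (rule theI)
    fix z assume "\<forall>x. ipV (T x) y = ipH x z"
    then show "z = T' y" using hilbert_module.eq_if_ip_eq[OF H] T' by simp
  qed (simp add: T')
  then show ?thesis by blast
qed

text \<open>
  The adjoint is available only on \<open>W\<close>, so the difference of the two sides is tested against itself;
  it lies in \<open>W\<close> because \<open>W\<close> is a submodule.
\<close>

lemma End_star_act:
  assumes H: "hilbert_module actH ipH" and V: "hilbert_module actV ipV"
    and W: "closed_submodule actV W" and T: "T \<in> End_star ipH ipV W"
  shows "T (actH a x) = actV a (T x)"
proof -
  interpret H: hilbert_module actH ipH by fact
  interpret V: hilbert_module actV ipV by fact
  have TW: "T z \<in> W" for z using T by (auto simp: End_star_def)
  define z where "z = T (actH a x) - actV a (T x)"
  have "z = T (actH a x) + actV (of_real (- 1)) (actV a (T x))"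
    by (simp add: z_def V.act_of_real del: of_real_minus)
  then have zW: "z \<in> W" using W TW by (simp add: closed_submodule_def)
  have "ipV z z = 0"
    unfolding z_def V.ip_diff_left
    by (simp add: V.ip_act_left ip_adj[OF H T zW, unfolded z_def] H.ip_act_left)
  then show ?thesis using V.ip_definite[of z] by (simp add: z_def)
qed

lemma adj_act:
  assumes H: "hilbert_module actH ipH" and V: "hilbert_module actV ipV"
    and T: "T \<in> End_star ipH ipV UNIV"
  shows "adj ipH ipV T (actV a y) = actH a (adj ipH ipV T y)"
proof (rule hilbert_module.eq_if_ip_eq[OF H])
  fix x show "ipH x (adj ipH ipV T (actV a y)) = ipH x (actH a (adj ipH ipV T y))"
    by (simp add: hilbert_module.ip_act_right[OF H] hilbert_module.ip_act_right[OF V]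
        flip: ip_adj[OF H T UNIV_I])
qed

section \<open>The Bochner integral in non-separable spaces\<close>

text \<open>
  The integrand is only an almost everywhere limit of simple functions and may fail to be measurable.
  Its distance to a simple function still agrees almost everywhere with a measurable function, which
  makes \<open>nn_integral\<close>, a lower integral, additive on such distances.
\<close>

lemma AE_measurable_norm_diff:
  fixes f :: "'w \<Rightarrow> 'b::real_normed_vector"
  assumes s: "\<And>i. simple_function M (s i)" and t: "simple_function M t"
    and lim: "AE \<omega> in M. (\<lambda>i. s i \<omega>) \<longlonglongrightarrow> f \<omega>"
  obtains g :: "'w \<Rightarrow> real" where "g \<in> borel_measurable M" "AE \<omega> in M. norm (f \<omega> - t \<omega>) = g \<omega>"
proof
  have "(\<lambda>\<omega>. norm (s i \<omega> - t \<omega>)) \<in> borel_measurable M" for i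
    by (intro borel_measurable_simple_function simple_function_compose2[OF s t])
  then show "(\<lambda>\<omega>. lim (\<lambda>i. norm (s i \<omega> - t \<omega>))) \<in> borel_measurable M" by measurable
  show "AE \<omega> in M. norm (f \<omega> - t \<omega>) = lim (\<lambda>i. norm (s i \<omega> - t \<omega>))"
    using lim by eventually_elim (rule limI[symmetric], intro tendsto_intros)
qed

lemma simple_function_if_simple_bochner_integrable:
  "Bochner_Integration.simple_bochner_integrable M s \<Longrightarrow> simple_function M s"
  by (simp add: Bochner_Integration.simple_bochner_integrable.simps)

lemma norm_simple_bochner_integral_diff_le:
  fixes f :: "'w \<Rightarrow> 'b::real_normed_vector"
  assumes u: "\<And>i. Bochner_Integration.simple_bochner_integrable M (u i)" and lim: "AE \<omega> in M. (\<lambda>i. u i \<omega>) \<longlonglongrightarrow> f \<omega>"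
    and s: "Bochner_Integration.simple_bochner_integrable M s" and t: "Bochner_Integration.simple_bochner_integrable M t"
  shows "ennreal (norm (Bochner_Integration.simple_bochner_integral M s - Bochner_Integration.simple_bochner_integral M t)) \<le>
    (\<integral>\<^sup>+\<omega>. norm (f \<omega> - s \<omega>) \<partial>M) + (\<integral>\<^sup>+\<omega>. norm (f \<omega> - t \<omega>) \<partial>M)"
proof -
  note sf = simple_function_if_simple_bochner_integrable
  obtain g where g: "g \<in> borel_measurable M" "AE \<omega> in M. norm (f \<omega> - s \<omega>) = g \<omega>"
    using AE_measurable_norm_diff[OF sf[OF u] sf[OF s] lim] by blast
  obtain h where h: "h \<in> borel_measurable M" "AE \<omega> in M. norm (f \<omega> - t \<omega>) = h \<omega>"
    using AE_measurable_norm_diff[OF sf[OF u] sf[OF t] lim] by blast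
  have "ennreal (norm (Bochner_Integration.simple_bochner_integral M s - Bochner_Integration.simple_bochner_integral M t)) =
      norm (Bochner_Integration.simple_bochner_integral M (\<lambda>\<omega>. s \<omega> - t \<omega>))"
    using s t by (simp add: simple_bochner_integral_diff)
  also have "\<dots> \<le> Bochner_Integration.simple_bochner_integral M (\<lambda>\<omega>. norm (s \<omega> - t \<omega>))"
    using simple_bochner_integrable_compose2[of "(-)" M s t] s t
    by (auto intro!: simple_bochner_integral_norm_bound)
  also have "\<dots> = (\<integral>\<^sup>+\<omega>. norm (s \<omega> - t \<omega>) \<partial>M)"
    using simple_bochner_integrable_compose2[of "\<lambda>x y. norm (x - y)" M s t] s t
    by (auto intro!: simple_bochner_integral_eq_nn_integral)
  also have "\<dots> \<le> (\<integral>\<^sup>+\<omega>. ennreal (g \<omega>) + ennreal (h \<omega>) \<partial>M)"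
    using g(2) h(2)
  proof (intro nn_integral_mono_AE, eventually_elim)
    fix \<omega> assume "norm (f \<omega> - s \<omega>) = g \<omega>" "norm (f \<omega> - t \<omega>) = h \<omega>"
    moreover have "norm (s \<omega> - t \<omega>) \<le> norm (f \<omega> - s \<omega>) + norm (f \<omega> - t \<omega>)"
      by (metis dual_order.refl norm_diff_triangle_le norm_minus_commute)
    ultimately show "ennreal (norm (s \<omega> - t \<omega>)) \<le> ennreal (g \<omega>) + ennreal (h \<omega>)"
      by (metis ennreal_leI ennreal_plus norm_ge_zero)
  qed
  also have "\<dots> = (\<integral>\<^sup>+\<omega>. ennreal (g \<omega>) \<partial>M) + (\<integral>\<^sup>+\<omega>. ennreal (h \<omega>) \<partial>M)"
    using g h by (intro nn_integral_add) auto
  also have "(\<integral>\<^sup>+\<omega>. ennreal (g \<omega>) \<partial>M) = (\<integral>\<^sup>+\<omega>. norm (f \<omega> - s \<omega>) \<partial>M)"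
    using g(2) by (intro nn_integral_cong_AE) auto
  also have "(\<integral>\<^sup>+\<omega>. ennreal (h \<omega>) \<partial>M) = (\<integral>\<^sup>+\<omega>. norm (f \<omega> - t \<omega>) \<partial>M)"
    using h(2) by (intro nn_integral_cong_AE) auto
  finally show ?thesis .
qed

lemma has_integral_bochner_unique:
  assumes "has_integral_bochner M f I" "has_integral_bochner M f J" shows "I = J"
proof -
  obtain s where s: "\<And>i. Bochner_Integration.simple_bochner_integrable M (s i)" "AE \<omega> in M. (\<lambda>i. s i \<omega>) \<longlonglongrightarrow> f \<omega>"
      "(\<lambda>i. \<integral>\<^sup>+\<omega>. norm (f \<omega> - s i \<omega>) \<partial>M) \<longlonglongrightarrow> 0"
      "(\<lambda>i. Bochner_Integration.simple_bochner_integral M (s i)) \<longlonglongrightarrow> I"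
    using assms(1) by (auto simp: has_integral_bochner_def)
  obtain t where t: "\<And>i. Bochner_Integration.simple_bochner_integrable M (t i)"
      "(\<lambda>i. \<integral>\<^sup>+\<omega>. norm (f \<omega> - t i \<omega>) \<partial>M) \<longlonglongrightarrow> 0"
      "(\<lambda>i. Bochner_Integration.simple_bochner_integral M (t i)) \<longlonglongrightarrow> J"
    using assms(2) by (auto simp: has_integral_bochner_def)
  let ?d = "\<lambda>i. norm (Bochner_Integration.simple_bochner_integral M (s i) - Bochner_Integration.simple_bochner_integral M (t i))"
  have "(\<lambda>i. ennreal (?d i)) \<longlonglongrightarrow> 0"
  proof (rule tendsto_sandwich[where f = "\<lambda>_. 0"])
    show "\<forall>\<^sub>F i in sequentially. ennreal (?d i) \<le>
        (\<integral>\<^sup>+\<omega>. norm (f \<omega> - s i \<omega>) \<partial>M) + (\<integral>\<^sup>+\<omega>. norm (f \<omega> - t i \<omega>) \<partial>M)"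
      using norm_simple_bochner_integral_diff_le[OF s(1,2) s(1) t(1)] by simp
    show "(\<lambda>i. (\<integral>\<^sup>+\<omega>. norm (f \<omega> - s i \<omega>) \<partial>M) + (\<integral>\<^sup>+\<omega>. norm (f \<omega> - t i \<omega>) \<partial>M)) \<longlonglongrightarrow> 0"
      using tendsto_add[OF s(3) t(2)] by simp
  qed auto
  then have "?d \<longlonglongrightarrow> 0" by (simp flip: ennreal_0)
  moreover have "?d \<longlonglongrightarrow> norm (I - J)" using s(4) t(3) by (intro tendsto_intros)
  ultimately have "norm (I - J) = 0" by (metis LIMSEQ_unique)
  then show ?thesis by simp
qed

lemma integral_bochner_eqI: "has_integral_bochner M f I \<Longrightarrow> integral_bochner M f = I"
  unfolding integral_bochner_def by (rule the_equality) (auto intro: has_integral_bochner_unique)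

lemma has_integral_integral_bochner:
  "integrable_bochner M f \<Longrightarrow> has_integral_bochner M f (integral_bochner M f)"
  by (auto simp: integrable_bochner_def integral_bochner_eqI)

lemma has_integral_bochner_cong:
  assumes "has_integral_bochner M f I" "\<And>\<omega>. \<omega> \<in> space M \<Longrightarrow> f \<omega> = g \<omega>"
  shows "has_integral_bochner M g I"
proof -
  have "(\<integral>\<^sup>+\<omega>. norm (f \<omega> - s \<omega>) \<partial>M) = (\<integral>\<^sup>+\<omega>. norm (g \<omega> - s \<omega>) \<partial>M)" for s
    using assms(2) by (intro nn_integral_cong) simp
  moreover have "(AE \<omega> in M. (\<lambda>i. s i \<omega>) \<longlonglongrightarrow> f \<omega>) \<longleftrightarrow> (AE \<omega> in M. (\<lambda>i. s i \<omega>) \<longlonglongrightarrow> g \<omega>)" for s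
    using assms(2) by (intro AE_cong) simp
  ultimately show ?thesis using assms(1) by (simp add: has_integral_bochner_def)
qed

lemma has_integral_bochner_linear:
  assumes T: "bounded_linear T" and f: "has_integral_bochner M f I"
  shows "has_integral_bochner M (\<lambda>\<omega>. T (f \<omega>)) (T I)"
proof -
  interpret T: bounded_linear T by fact
  obtain s where s: "\<And>i. Bochner_Integration.simple_bochner_integrable M (s i)" "AE \<omega> in M. (\<lambda>i. s i \<omega>) \<longlonglongrightarrow> f \<omega>"
      "(\<lambda>i. \<integral>\<^sup>+\<omega>. norm (f \<omega> - s i \<omega>) \<partial>M) \<longlonglongrightarrow> 0"
      "(\<lambda>i. Bochner_Integration.simple_bochner_integral M (s i)) \<longlonglongrightarrow> I"
    using f by (auto simp: has_integral_bochner_def)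
  obtain C where C: "C \<ge> 0" "\<And>x. norm (T x) \<le> norm x * C" using T.nonneg_bounded by blast
  show ?thesis unfolding has_integral_bochner_def
  proof (intro exI[of _ "\<lambda>i \<omega>. T (s i \<omega>)"] conjI allI)
    show "Bochner_Integration.simple_bochner_integrable M (\<lambda>\<omega>. T (s i \<omega>))" for i
      using simple_bochner_integrable_compose2[of "\<lambda>x y. T x", OF T.zero s(1) s(1)] .
    show "AE \<omega> in M. (\<lambda>i. T (s i \<omega>)) \<longlonglongrightarrow> T (f \<omega>)"
      using s(2) by eventually_elim (rule T.tendsto)
    show "(\<lambda>i. Bochner_Integration.simple_bochner_integral M (\<lambda>\<omega>. T (s i \<omega>))) \<longlonglongrightarrow> T I"
      using T.tendsto[OF s(4)] by (simp add: simple_bochner_integral_linear[OF T.linear_axioms s(1)])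
    have le: "(\<integral>\<^sup>+\<omega>. norm (T (f \<omega>) - T (s i \<omega>)) \<partial>M) \<le> C * (\<integral>\<^sup>+\<omega>. norm (f \<omega> - s i \<omega>) \<partial>M)" for i
    proof -
      note sf = simple_function_if_simple_bochner_integrable
      obtain g where g: "g \<in> borel_measurable M" "AE \<omega> in M. norm (f \<omega> - s i \<omega>) = g \<omega>"
        using AE_measurable_norm_diff[OF sf[OF s(1)] sf[OF s(1)] s(2)] by blast
      have "(\<integral>\<^sup>+\<omega>. norm (T (f \<omega>) - T (s i \<omega>)) \<partial>M) \<le> (\<integral>\<^sup>+\<omega>. ennreal C * ennreal (g \<omega>) \<partial>M)"
        using g(2)
      proof (intro nn_integral_mono_AE, eventually_elim)
        fix \<omega> assume "norm (f \<omega> - s i \<omega>) = g \<omega>"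
        then have "norm (T (f \<omega>) - T (s i \<omega>)) \<le> C * g \<omega>"
          using C(2)[of "f \<omega> - s i \<omega>"] by (simp add: T.diff mult.commute)
        then show "ennreal (norm (T (f \<omega>) - T (s i \<omega>))) \<le> ennreal C * ennreal (g \<omega>)"
          using C(1) by (simp add: ennreal_leI flip: ennreal_mult')
      qed
      also have "\<dots> = ennreal C * (\<integral>\<^sup>+\<omega>. ennreal (g \<omega>) \<partial>M)"
        using g(1) by (intro nn_integral_cmult) auto
      also have "(\<integral>\<^sup>+\<omega>. ennreal (g \<omega>) \<partial>M) = (\<integral>\<^sup>+\<omega>. norm (f \<omega> - s i \<omega>) \<partial>M)"
        using g(2) by (intro nn_integral_cong_AE) auto
      finally show ?thesis .
    qed
    have "(\<lambda>i. ennreal C * (\<integral>\<^sup>+\<omega>. norm (f \<omega> - s i \<omega>) \<partial>M)) \<longlonglongrightarrow> ennreal C * 0"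
      using s(3) by (intro ennreal_tendsto_cmult) auto
    then have "(\<lambda>i. ennreal C * (\<integral>\<^sup>+\<omega>. norm (f \<omega> - s i \<omega>) \<partial>M)) \<longlonglongrightarrow> 0" by simp
    then show "(\<lambda>i. \<integral>\<^sup>+\<omega>. norm (T (f \<omega>) - T (s i \<omega>)) \<partial>M) \<longlonglongrightarrow> 0"
      by (rule tendsto_sandwich[rotated 3]) (auto simp: le)
  qed
qed

section \<open>Characterisation of continuous $*$-K-g-frames by the frame operator\<close>

lemma strictly_nonzero_iff_alg_invertible: "strictly_nonzero a \<longleftrightarrow> alg_invertible a"
proof -
  have "(0::complex) *\<^sub>C 1 - a = - a" using scaleC_of_real[of 0 "1::'a"] by simp
  then show ?thesis by (simp add: strictly_nonzero_def spectrum_def alg_invertible_minus_iff)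
qed

lemma bounded_linear_conj_star:
  "bounded_linear (\<lambda>y::'a::unital_cstar_algebra. a * y * star a)"
  by (intro bounded_linear_compose[OF bounded_linear_mult_left[of "star a"]] bounded_linear_mult_right)

theorem theorem2p7:
  fixes M :: "'w measure"
    and actH :: "'a::unital_cstar_algebra \<Rightarrow> 'h::banach \<Rightarrow> 'h"
    and ipH :: "'h \<Rightarrow> 'h \<Rightarrow> 'a"
    and actV :: "'a \<Rightarrow> 'v::banach \<Rightarrow> 'v"
    and ipV :: "'v \<Rightarrow> 'v \<Rightarrow> 'a"
    and Hs :: "'w \<Rightarrow> 'v set"
    and K :: "'h \<Rightarrow> 'h"
    and \<Lambda> :: "'w \<Rightarrow> 'h \<Rightarrow> 'v"
  assumes "hilbert_module actH ipH"
    and "hilbert_module actV ipV"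
    and "\<And>\<omega>. \<omega> \<in> space M \<Longrightarrow> closed_submodule actV (Hs \<omega>)"
    and "K \<in> End_star ipH ipH UNIV"
    and "continuous_star_g_Bessel M ipH ipV Hs \<Lambda>"
    and "\<And>x. integrable_bochner M (\<lambda>\<omega>. adj ipH ipV (\<Lambda> \<omega>) (\<Lambda> \<omega> x))"
  shows "continuous_star_K_g_frame M ipH ipV Hs K \<Lambda> \<longleftrightarrow>
    (\<exists>A::real. A > 0 \<and>
      op_le ipH (\<lambda>x. A *\<^sub>R K (adj ipH ipH K x)) (frame_operator M ipH ipV \<Lambda>))"
proof -
  interpret H: hilbert_module actH ipH by fact
  interpret V: hilbert_module actV ipV by fact
  define p where "p x = integral_bochner M (\<lambda>\<omega>. ipV (\<Lambda> \<omega> x) (\<Lambda> \<omega> x))" for x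
  define q where "q x = ipH (adj ipH ipH K x) (adj ipH ipH K x)" for x
  note Bessel = assms(5)[unfolded continuous_star_g_Bessel_def]
  have \<Lambda>: "\<Lambda> \<omega> \<in> End_star ipH ipV (Hs \<omega>)" if "\<omega> \<in> space M" for \<omega>
    using Bessel that by blast
  have p: "has_integral_bochner M (\<lambda>\<omega>. ipV (\<Lambda> \<omega> x) (\<Lambda> \<omega> x)) (p x)" for x
    unfolding p_def using Bessel by (intro has_integral_integral_bochner) blast
  have S: "ipH (frame_operator M ipH ipV \<Lambda> x) x = p x" for x
  proof (rule has_integral_bochner_unique[OF has_integral_bochner_cong p])
    show "has_integral_bochner M (\<lambda>\<omega>. ipH (adj ipH ipV (\<Lambda> \<omega>) (\<Lambda> \<omega> x)) x)
        (ipH (frame_operator M ipH ipV \<Lambda> x) x)"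
      unfolding frame_operator_def
      by (rule has_integral_bochner_linear[OF H.bounded_linear_ip_left
            has_integral_integral_bochner[OF assms(6)]])
    fix \<omega> assume \<omega>: "\<omega> \<in> space M"
    have "\<Lambda> \<omega> x \<in> Hs \<omega>" using \<Lambda>[OF \<omega>] by (auto simp: End_star_def)
    then have "ipH x (adj ipH ipV (\<Lambda> \<omega>) (\<Lambda> \<omega> x)) = ipV (\<Lambda> \<omega> x) (\<Lambda> \<omega> x)"
      using ip_adj[OF assms(1) \<Lambda>[OF \<omega>]] by metis
    then show "ipH (adj ipH ipV (\<Lambda> \<omega>) (\<Lambda> \<omega> x)) x = ipV (\<Lambda> \<omega> x) (\<Lambda> \<omega> x)"
      using H.ip_star[of _ x] V.ip_star by metis
  qed
  have KK: "ipH (A *\<^sub>R K (adj ipH ipH K x)) x = A *\<^sub>R q x" for A x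
    by (simp add: H.ip_scaleR_left ip_adj[OF assms(1,4)] q_def)
  have p_act: "p (actH a x) = a * p x * star a" for a x
  proof (rule has_integral_bochner_unique[OF p])
    show "has_integral_bochner M (\<lambda>\<omega>. ipV (\<Lambda> \<omega> (actH a x)) (\<Lambda> \<omega> (actH a x))) (a * p x * star a)"
      by (rule has_integral_bochner_cong[OF has_integral_bochner_linear[OF bounded_linear_conj_star p]])
         (simp add: End_star_act[OF assms(1,2,3) \<Lambda>] V.ip_act_left V.ip_act_right mult.assoc)
  qed
  have q_act: "q (actH a x) = a * q x * star a" for a x
    by (simp add: q_def adj_act[OF assms(1,1,4)] H.ip_act_left H.ip_act_right mult.assoc)
  have frame_iff: "continuous_star_K_g_frame M ipH ipV Hs K \<Lambda> \<longleftrightarrow>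
      (\<exists>A'. alg_invertible A' \<and> (\<forall>x. norm_positive (p x - A' * q x * star A')))"
    using Bessel
    unfolding continuous_star_K_g_frame_def cstar_le_def p_def q_def
      cstar_positive_iff_norm_positive strictly_nonzero_iff_alg_invertible
    by blast
  have op_le_iff: "op_le ipH (\<lambda>x. A *\<^sub>R K (adj ipH ipH K x)) (frame_operator M ipH ipV \<Lambda>) \<longleftrightarrow>
      (\<forall>x. norm_positive (p x - A *\<^sub>R q x))" for A
    by (simp add: op_le_def cstar_le_def cstar_positive_iff_norm_positive S KK)
  have "\<exists>A>0. \<forall>x. norm_positive (p x - A *\<^sub>R q x)"
    if A': "alg_invertible A'" "\<And>x. norm_positive (p x - A' * q x * star A')" for A'
  proof -
    obtain E where E: "A' * E = 1" "E * A' = 1" using A' by (auto simp: alg_invertible_def)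
    \<comment> \<open>Cancelling \<open>A'\<close> costs at most the factor \<open>(norm E)\<^sup>2\<close> in norm.\<close>
    define L where "L = (norm E)\<^sup>2"
    have L: "L > 0" using E by (auto simp: L_def)
    have lower: "norm_positive (A' * q x * star A')" for x
      using H.norm_positive_ip_self[of "actH A' (adj ipH ipH K x)"]
      by (simp add: q_def H.ip_act_left H.ip_act_right mult.assoc)
    have dom: "norm (q x) \<le> L * norm (p x)" for x
    proof -
      have "star A' * star E = 1" using E by (simp flip: star_mult)
      then have "E * (A' * q x * star A') * star E = q x" using E
        by (simp add: mult.assoc) (simp flip: mult.assoc)
      then have "norm (q x) \<le> norm (E * (A' * q x * star A')) * norm (star E)"
        by (metis norm_mult_ineq)
      also have "\<dots> \<le> (norm E * norm (A' * q x * star A')) * norm (star E)"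
        by (intro mult_right_mono norm_mult_ineq) simp
      also have "\<dots> = L * norm (A' * q x * star A')" by (simp add: L_def power2_eq_square)
      also have "\<dots> \<le> L * norm (p x)"
        using L by (intro mult_left_mono norm_mono_positive lower A') simp
      finally show ?thesis .
    qed
    have "norm_positive (p x - (1 / L) *\<^sub>R q x)" for x
    proof -
      have "norm_positive (L *\<^sub>R p x - q x)"
      proof (rule positive_if_norm_dominated)
        show "norm_positive (p x)" using norm_positive_add[OF A'(2) lower, of x x] by simp
        show "star (q x) = q x" using H.ip_star unfolding q_def by metis
        show "L \<ge> 0" using L by simp
        \<comment> \<open>The norm bound at \<open>actH a x\<close> is the bound for the two-sided products with \<open>a\<close>.\<close>
        fix a :: 'a assume "star a = a"
        then show "norm (a * q x * a) \<le> L * norm (a * p x * a)"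
          using dom[of "actH a x"] by (simp add: p_act q_act)
      qed
      from norm_positive_scaleR[OF this, of "1 / L"] L show ?thesis
        by (simp add: scaleR_right_diff_distrib)
    qed
    with L show ?thesis by (intro exI[of _ "1 / L"]) simp
  qed
  moreover have "\<exists>A'. alg_invertible A' \<and> (\<forall>x. norm_positive (p x - A' * q x * star A'))"
    if A: "A > 0" "\<And>x. norm_positive (p x - A *\<^sub>R q x)" for A
  proof (intro exI[of _ "of_real (sqrt A)"] conjI allI)
    show "alg_invertible (of_real (sqrt A) :: 'a)" using A by (intro alg_invertible_of_real) simp
    fix x
    have "of_real (sqrt A) * q x * star (of_real (sqrt A)) = A *\<^sub>R q x"
      using A(1) unfolding star_of_real by (simp add: of_real_def)
    then show "norm_positive (p x - of_real (sqrt A) * q x * star (of_real (sqrt A)))"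
      using A(2)[of x] by simp
  qed
  ultimately show ?thesis unfolding frame_iff op_le_iff by blast
qed

end
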